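(* Let $\Gamma=\mathbb{Z}/k\mathbb{Z}$ be a cyclic group of order $k$, let $G$ be a finite simple graph with an action $\theta:\Gamma\to\mathrm{Aut}(G)$ that is free on $V(G)$ and on $E(G)$, let $\tau:\Gamma\to O(\mathbb{R}^d)$ be a homomorphism, let $(G,p)$ be a $\Gamma$-symmetric framework in $\mathbb{R}^d$ with respect to $\theta$ and $\tau$, and let $(H,\psi)$ be the quotient $\Gamma$-gain graph of $G$, with $\tilde p:V(H)\to\mathbb{R}^d$ the quotient of $p$. Then for each $j=0,\dots,k-1$, $$\operatorname{rank}\widetilde R_j(G,p)=\operatorname{rank} O_j(H,\psi,\tilde p).$$
   Context: A framework $(G,p)$ in $\mathbb{R}^d$ is a finite simple graph $G$ with a map $p:V(G)\to\mathbb{R}^d$ such that $p(u)\ne p(v)$ for all $\{u,v\}\in E(G)$. Its rigidity matrix $R(G,p)$ is the $|E(G)|\times d|V(G)|$ matrix whose row for $\{u,v\}$ has $(p(u)-p(v))^\top$ in the $d$ columns of $u$, $(p(v)-p(u))^\top$ in the $d$ columns of $v$, and $0$ elsewhere. It is regarded here as a linear map $(\mathbb{C}^d)^{V(G)}\to\mathbb{C}^{E(G)}$. An action of $\Gamma$ on $G$ is a homomorphism $\theta:\Gamma\to\mathrm{Aut}(G)$; write $\gamma v=\theta(\gamma)(v)$. It is free on $V(G)$ (resp. $E(G)$) if no non-identity element fixes a vertex (resp. an edge, as an unordered pair). $(G,p)$ is $\Gamma$-symmetric with respect to $\theta,\tau$ if $\tau(\gamma)p(v)=p(\gamma v)$ for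 all $\gamma\in\Gamma$, $v\in V(G)$. Quotient gain graph: choose one representative vertex in each vertex orbit. $V(H)$ is the set of vertex orbits and $E(H)$ the set of edge orbits. An edge orbit joining the orbits of representatives $u$ and $v$ has the form $\{\{\gamma u,\gamma h v\}:\gamma\in\Gamma\}$ for some $h\in\Gamma$ (unique once the orbit is oriented from the orbit of $u$ to that of $v$); it is a directed edge (possibly a loop) of $H$ from the orbit of $u$ to that of $v$ with gain $\psi_{\tilde e}=h$. The quotient $\tilde p$ of $p$ assigns to each vertex orbit the point $p(v)$ of its representative $v$. Irreducible representations: $\omega=e^{2\pi\sqrt{-1}/k}$ and $\rho_j(i)=\omega^{ij}$ for $i\in\mathbb{Z}/k\mathbb{Z}$, $j=0,\dots,k-1$. Block $\widetilde R_j(G,p)$: let $J_j^{\rm mo}=\{m\in(\mathbb{C}^d)^{V(G)}: m(\gamma v)=\overline{\omega}^{\,j\gamma}\tau(\gamma)m(v)\ \forall\gamma\in\Gamma, v\in V(G)\}$ and $I_j^{\rm st}=\{w\in\mathbb{C}^{E(G)}: w(\gamma e)=\overline{\omega}^{\,j\gamma}w(e)\ \forall\gamma\in\Gamma,e\in E(G)\}$. These are the $\rho_j$-isotypic subspaces, and $R(G,p)$ maps $J_j^{\rm mo}$ into $I_j^{\rm st}$. $\widetilde R_j(G,p)$ is (a matrix of) the restricted map $J_j^{\rm mo}\to I_j^{\rm st}$. Orbit rigidity matrix $O_j(H,\psi,\tilde p)$: the $|E(H)|\times d|V(H)|$ complex matrix whose row for $\tilde e=(\tilde u,\tilde v)\in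 E(H)$ has $(\tilde p(\tilde u)-\tau(\psi_{\tilde e})\tilde p(\tilde v))^\top$ in the $d$ columns of $\tilde u$, $\omega^{j\psi_{\tilde e}}(\tilde p(\tilde v)-\tau(\psi_{\tilde e})^{-1}\tilde p(\tilde u))^\top$ in the $d$ columns of $\tilde v$, and $0$ elsewhere; if $\tilde e$ is a loop at $\tilde v$, the entries in the columns of $\tilde v$ are the sum of these two vectors. *)

theory Defs
  imports
    "HOL-Analysis.Analysis"
    "HOL-Algebra.Elementary_Groups"
    "HOL-Algebra.Group_Action"
    "HOL-Library.Function_Algebras"
begin

section \<open>Complex linear algebra indexed by arbitrary finite sets\<close>

text \<open>For a finite set \<open>A\<close>, the space of complex vectors indexed by \<open>A\<close> is realised as the set of
  functions on the ambient type that vanish outside \<open>A\<close>.\<close>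

definition fun_scale :: "complex \<Rightarrow> ('a \<Rightarrow> complex) \<Rightarrow> 'a \<Rightarrow> complex" where
  "fun_scale c f = (\<lambda>x. c * f x)"

global_interpretation cfun: vector_space fun_scale
  by unfold_locales (auto simp: fun_scale_def fun_eq_iff algebra_simps)

definition map_rank :: "'b set \<Rightarrow> ('b \<Rightarrow> 'a \<Rightarrow> complex) \<Rightarrow> nat" where
  "map_rank S f = cfun.dim (f ` S)"

text \<open>Rank of the matrix with entries \<open>M a b\<close>, rows \<open>a \<in> A\<close> and columns \<open>b \<in> B\<close>, as the
  dimension of its column space.\<close>

definition matrix_rank_on :: "'a set \<Rightarrow> 'b set \<Rightarrow> ('a \<Rightarrow> 'b \<Rightarrow> complex) \<Rightarrow> nat" where
  "matrix_rank_on A B M = cfun.dim ((\<lambda>b a. if a \<in> A then M a b else 0) ` B)"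

definition complex_matrix :: "real^'n^'m \<Rightarrow> complex^'n^'m" where
  "complex_matrix = map_matrix complex_of_real"


section \<open>Symmetric frameworks\<close>

definition finite_simple_graph :: "'v set \<Rightarrow> 'v set set \<Rightarrow> bool" where
  "finite_simple_graph V E \<longleftrightarrow> finite V \<and> (\<forall>e\<in>E. \<exists>u\<in>V. \<exists>v\<in>V. u \<noteq> v \<and> e = {u, v})"

definition graph_aut_group :: "'v set \<Rightarrow> 'v set set \<Rightarrow> ('v \<Rightarrow> 'v) monoid" where
  "graph_aut_group V E =
     BijGroup V \<lparr>carrier := {f \<in> Bij V. \<forall>u\<in>V. \<forall>v\<in>V. {f u, f v} \<in> E \<longleftrightarrow> {u, v} \<in> E}\<rparr>"

definition edge_action :: "('g \<Rightarrow> 'v \<Rightarrow> 'v) \<Rightarrow> 'g \<Rightarrow> 'v set \<Rightarrow> 'v set" where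
  "edge_action \<theta> g e = \<theta> g ` e"

definition free_on :: "('g, 'm) monoid_scheme \<Rightarrow> 'x set \<Rightarrow> ('g \<Rightarrow> 'x \<Rightarrow> 'x) \<Rightarrow> bool" where
  "free_on \<Gamma> X \<phi> \<longleftrightarrow> (\<forall>g\<in>carrier \<Gamma>. g \<noteq> \<one>\<^bsub>\<Gamma>\<^esub> \<longrightarrow> (\<forall>x\<in>X. \<phi> g x \<noteq> x))"

definition orthogonal_group :: "(real^'d^'d) monoid" where
  "orthogonal_group = \<lparr>carrier = {A. orthogonal_matrix A}, monoid.mult = (**), one = mat 1\<rparr>"

definition framework :: "'v set \<Rightarrow> 'v set set \<Rightarrow> ('v \<Rightarrow> real^'d) \<Rightarrow> bool" where
  "framework V E p \<longleftrightarrow> finite_simple_graph V E \<and> (\<forall>u v. {u, v} \<in> E \<longrightarrow> p u \<noteq> p v)"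

definition symmetric_framework ::
  "('g, 'm) monoid_scheme \<Rightarrow> ('g \<Rightarrow> 'v \<Rightarrow> 'v) \<Rightarrow> ('g \<Rightarrow> real^'d^'d) \<Rightarrow> 'v set \<Rightarrow> 'v set set
     \<Rightarrow> ('v \<Rightarrow> real^'d) \<Rightarrow> bool" where
  "symmetric_framework \<Gamma> \<theta> \<tau> V E p \<longleftrightarrow>
     framework V E p \<and> (\<forall>g\<in>carrier \<Gamma>. \<forall>v\<in>V. \<tau> g *v p v = p (\<theta> g v))"


section \<open>The rigidity matrix and its blocks\<close>

definition rigidity_matrix :: "('v \<Rightarrow> real^'d) \<Rightarrow> 'v set \<Rightarrow> 'v \<times> 'd \<Rightarrow> real" where
  "rigidity_matrix p e = (\<lambda>(v, i). if v \<in> e then (p v - p (THE u. e = {v, u})) $ i else 0)"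

lemma rigidity_matrix_edge:
  assumes "u \<noteq> v"
  shows "rigidity_matrix p {u, v} (u, i) = (p u - p v) $ i"
    and "rigidity_matrix p {u, v} (v, i) = (p v - p u) $ i"
    and "w \<notin> {u, v} \<Longrightarrow> rigidity_matrix p {u, v} (w, i) = 0"
proof -
  have "(THE w. {u, v} = {u, w}) = v" "(THE w. {u, v} = {v, w}) = u"
    by (rule the_equality; use assms in \<open>auto simp: doubleton_eq_iff\<close>)+
  then show "rigidity_matrix p {u, v} (u, i) = (p u - p v) $ i"
    and "rigidity_matrix p {u, v} (v, i) = (p v - p u) $ i"
    and "w \<notin> {u, v} \<Longrightarrow> rigidity_matrix p {u, v} (w, i) = 0"
    by (auto simp: rigidity_matrix_def)
qed

definition rigidity_map ::
  "'v set \<Rightarrow> 'v set set \<Rightarrow> ('v \<Rightarrow> real^'d) \<Rightarrow> ('v \<Rightarrow> complex^'d) \<Rightarrow> 'v set \<Rightarrow> complex" where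
  "rigidity_map V E p m = (\<lambda>e. if e \<in> E
     then \<Sum>v\<in>V. \<Sum>i\<in>UNIV. complex_of_real (rigidity_matrix p e (v, i)) * m v $ i else 0)"

definition unit_root :: "nat \<Rightarrow> complex" where
  "unit_root k = exp (2 * of_real pi * \<i> / of_nat k)"

text \<open>In the isotypic subspaces the group is \<open>integer_mod_group k\<close>, whose elements are the integers
  \<open>0, \<dots>, k - 1\<close>.\<close>

definition motion_isotypic ::
  "nat \<Rightarrow> (int \<Rightarrow> 'v \<Rightarrow> 'v) \<Rightarrow> (int \<Rightarrow> real^'d^'d) \<Rightarrow> nat \<Rightarrow> 'v set \<Rightarrow> ('v \<Rightarrow> complex^'d) set" where
  "motion_isotypic k \<theta> \<tau> j V =
     {m. (\<forall>v. v \<notin> V \<longrightarrow> m v = 0) \<and>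
         (\<forall>g\<in>carrier (integer_mod_group k). \<forall>v\<in>V.
            m (\<theta> g v) = (cnj (unit_root k) powi (int j * g)) *s (complex_matrix (\<tau> g) *v m v))}"

definition stress_isotypic ::
  "nat \<Rightarrow> (int \<Rightarrow> 'v \<Rightarrow> 'v) \<Rightarrow> nat \<Rightarrow> 'v set set \<Rightarrow> ('v set \<Rightarrow> complex) set" where
  "stress_isotypic k \<theta> j E =
     {w. (\<forall>e. e \<notin> E \<longrightarrow> w e = 0) \<and>
         (\<forall>g\<in>carrier (integer_mod_group k). \<forall>e\<in>E.
            w (edge_action \<theta> g e) = cnj (unit_root k) powi (int j * g) * w e)}"

text \<open>The \<open>j\<close>-th block is the rigidity map with domain restricted to the motion isotypic subspace;
  \<open>block_map_in\<close> below shows that its codomain is the stress isotypic subspace.\<close>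

definition block_map ::
  "nat \<Rightarrow> (int \<Rightarrow> 'v \<Rightarrow> 'v) \<Rightarrow> (int \<Rightarrow> real^'d^'d) \<Rightarrow> nat \<Rightarrow> 'v set \<Rightarrow> 'v set set \<Rightarrow> ('v \<Rightarrow> real^'d)
     \<Rightarrow> ('v \<Rightarrow> complex^'d) \<Rightarrow> 'v set \<Rightarrow> complex" where
  "block_map k \<theta> \<tau> j V E p = restrict (rigidity_map V E p) (motion_isotypic k \<theta> \<tau> j V)"

definition block_rank ::
  "nat \<Rightarrow> (int \<Rightarrow> 'v \<Rightarrow> 'v) \<Rightarrow> (int \<Rightarrow> real^'d^'d) \<Rightarrow> nat \<Rightarrow> 'v set \<Rightarrow> 'v set set \<Rightarrow> ('v \<Rightarrow> real^'d)
     \<Rightarrow> nat" where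
  "block_rank k \<theta> \<tau> j V E p = map_rank (motion_isotypic k \<theta> \<tau> j V) (block_map k \<theta> \<tau> j V E p)"

lemma rigidity_map_edge:
  assumes "finite V" "u \<in> V" "v \<in> V" "u \<noteq> v" "{u, v} \<in> E"
  shows "rigidity_map V E p m {u, v} =
    (\<Sum>i\<in>UNIV. complex_of_real ((p u - p v) $ i) * (m u - m v) $ i)"
proof -
  have "rigidity_map V E p m {u, v} =
      (\<Sum>w\<in>V. \<Sum>i\<in>UNIV. complex_of_real (rigidity_matrix p {u, v} (w, i)) * m w $ i)"
    using assms by (simp add: rigidity_map_def)
  also have "\<dots> = (\<Sum>w\<in>{u, v}. \<Sum>i\<in>UNIV. complex_of_real (rigidity_matrix p {u, v} (w, i)) * m w $ i)"
    by (rule sum.mono_neutral_right) (use assms in \<open>auto simp: rigidity_matrix_edge\<close>)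
  also have "\<dots> = (\<Sum>i\<in>UNIV. complex_of_real ((p u - p v) $ i) * m u $ i)
                + (\<Sum>i\<in>UNIV. complex_of_real ((p v - p u) $ i) * m v $ i)"
    using assms by (simp add: rigidity_matrix_edge)
  also have "\<dots> = (\<Sum>i\<in>UNIV. complex_of_real ((p u - p v) $ i) * (m u - m v) $ i)"
    by (simp add: sum.distrib [symmetric] algebra_simps)
  finally show ?thesis .
qed

lemma orthogonal_bilinear:
  fixes A :: "real^'d^'d" and x :: "real^'d" and y :: "complex^'d"
  assumes "orthogonal_matrix A"
  shows "(\<Sum>i\<in>UNIV. complex_of_real ((A *v x) $ i) * (complex_matrix A *v y) $ i)
       = (\<Sum>i\<in>UNIV. complex_of_real (x $ i) * y $ i)"
proof -
  have orth: "(\<Sum>i\<in>UNIV. A $ i $ a * A $ i $ b) = (if a = b then 1 else 0)" for a b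
  proof -
    have "(transpose A ** A) $ a $ b = mat 1 $ a $ b"
      using assms by (simp add: orthogonal_matrix)
    then show ?thesis
      by (simp add: matrix_matrix_mult_def transpose_def mat_def)
  qed
  have "(\<Sum>i\<in>UNIV. complex_of_real ((A *v x) $ i) * (complex_matrix A *v y) $ i)
      = (\<Sum>i\<in>UNIV. \<Sum>a\<in>UNIV. \<Sum>b\<in>UNIV.
           complex_of_real (A $ i $ a * A $ i $ b) * (complex_of_real (x $ a) * y $ b))"
    unfolding matrix_vector_mult_def complex_matrix_def vec_lambda_beta nth_map_matrix of_real_sum
      sum_product
    by (simp add: mult_ac)
  also have "\<dots> = (\<Sum>a\<in>UNIV. \<Sum>b\<in>UNIV. \<Sum>i\<in>UNIV.
           complex_of_real (A $ i $ a * A $ i $ b) * (complex_of_real (x $ a) * y $ b))"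
    by (subst sum.swap, rule sum.cong[OF refl], rule sum.swap)
  also have "\<dots> = (\<Sum>a\<in>UNIV. \<Sum>b\<in>UNIV.
           complex_of_real (\<Sum>i\<in>UNIV. A $ i $ a * A $ i $ b) * (complex_of_real (x $ a) * y $ b))"
    by (simp only: of_real_sum sum_distrib_right)
  also have "\<dots> = (\<Sum>a\<in>UNIV. \<Sum>b\<in>UNIV. if a = b then complex_of_real (x $ a) * y $ b else 0)"
    unfolding orth by (intro sum.cong) auto
  also have "\<dots> = (\<Sum>a\<in>UNIV. complex_of_real (x $ a) * y $ a)"
    by simp
  finally show ?thesis .
qed

lemma block_map_in:
  assumes \<theta>: "\<theta> \<in> hom (integer_mod_group k) (graph_aut_group V E)"
    and \<tau>: "\<tau> \<in> hom (integer_mod_group k) orthogonal_group"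
    and p: "symmetric_framework (integer_mod_group k) \<theta> \<tau> V E p"
  shows "block_map k \<theta> \<tau> j V E p \<in> motion_isotypic k \<theta> \<tau> j V \<rightarrow> stress_isotypic k \<theta> j E"
proof
  fix m assume m: "m \<in> motion_isotypic k \<theta> \<tau> j V"
  have G: "finite_simple_graph V E"
    using p by (auto simp: symmetric_framework_def framework_def)
  then have finV: "finite V"
    by (simp add: finite_simple_graph_def)
  have eq: "rigidity_map V E p m (edge_action \<theta> g e)
          = cnj (unit_root k) powi (int j * g) * rigidity_map V E p m e"
    if g: "g \<in> carrier (integer_mod_group k)" and e: "e \<in> E" for g e
  proof -
    let ?c = "cnj (unit_root k) powi (int j * g)"
    obtain u v where uv: "u \<in> V" "v \<in> V" "u \<noteq> v" "e = {u, v}"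
      using G e unfolding finite_simple_graph_def by blast
    have aut: "\<theta> g \<in> Bij V" "{\<theta> g u, \<theta> g v} \<in> E"
      using \<theta> g uv e by (auto simp: hom_def graph_aut_group_def Pi_iff)
    have bij: "bij_betw (\<theta> g) V V" using aut by (simp add: Bij_def)
    have uv': "\<theta> g u \<in> V" "\<theta> g v \<in> V" "\<theta> g u \<noteq> \<theta> g v"
      using bij uv by (auto simp: bij_betw_def inj_on_def)
    have orth: "orthogonal_matrix (\<tau> g)"
      using \<tau> g by (auto simp: hom_def orthogonal_group_def Pi_iff)
    have pp: "p (\<theta> g u) - p (\<theta> g v) = \<tau> g *v (p u - p v)"
      using p g uv by (auto simp: symmetric_framework_def matrix_vector_mult_diff_distrib)
    have mm: "m (\<theta> g u) - m (\<theta> g v) = ?c *s (complex_matrix (\<tau> g) *v (m u - m v))"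
      using m g uv by (auto simp: motion_isotypic_def matrix_vector_mult_diff_distrib
          vector_ssub_ldistrib)
    have "rigidity_map V E p m (edge_action \<theta> g e) = (\<Sum>i\<in>UNIV.
            complex_of_real ((\<tau> g *v (p u - p v)) $ i)
              * (?c *s (complex_matrix (\<tau> g) *v (m u - m v))) $ i)"
      using rigidity_map_edge[OF finV uv' aut(2), of p m]
      unfolding pp mm by (simp add: edge_action_def uv(4))
    also have "\<dots> = ?c * (\<Sum>i\<in>UNIV. complex_of_real ((\<tau> g *v (p u - p v)) $ i)
                            * (complex_matrix (\<tau> g) *v (m u - m v)) $ i)"
      by (simp add: sum_distrib_left mult.left_commute)
    also have "\<dots> = ?c * rigidity_map V E p m e"
      unfolding orthogonal_bilinear[OF orth] using rigidity_map_edge[OF finV uv(1-3), of E p m] e uv(4)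
      by simp
    finally show ?thesis .
  qed
  show "block_map k \<theta> \<tau> j V E p m \<in> stress_isotypic k \<theta> j E"
    using m eq by (auto simp: block_map_def stress_isotypic_def rigidity_map_def)
qed


section \<open>Quotient gain graphs and orbit rigidity matrices\<close>

text \<open>The vertex and edge sets of the quotient are \<open>orbits \<Gamma> V \<theta>\<close> and
  \<open>orbits \<Gamma> E (edge_action \<theta>)\<close>. The predicate holds for every choice of representatives \<open>r\<close> and of an
  orientation (tail \<open>s\<close>, head \<open>t\<close>) of each edge orbit, with corresponding gains \<open>\<psi>\<close>; an edge orbit
  may be a loop, i.e. have equal tail and head.\<close>

definition quotient_gain_graph ::
  "('g, 'm) monoid_scheme \<Rightarrow> ('g \<Rightarrow> 'v \<Rightarrow> 'v) \<Rightarrow> 'v set \<Rightarrow> 'v set set \<Rightarrow> ('v set \<Rightarrow> 'v)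
     \<Rightarrow> ('v set set \<Rightarrow> 'v set) \<Rightarrow> ('v set set \<Rightarrow> 'v set) \<Rightarrow> ('v set set \<Rightarrow> 'g) \<Rightarrow> bool" where
  "quotient_gain_graph \<Gamma> \<theta> V E r s t \<psi> \<longleftrightarrow>
     (\<forall>a\<in>orbits \<Gamma> V \<theta>. r a \<in> a) \<and>
     (\<forall>b\<in>orbits \<Gamma> E (edge_action \<theta>).
        s b \<in> orbits \<Gamma> V \<theta> \<and> t b \<in> orbits \<Gamma> V \<theta> \<and> \<psi> b \<in> carrier \<Gamma> \<and>
        b = {{\<theta> g (r (s b)), \<theta> (g \<otimes>\<^bsub>\<Gamma>\<^esub> \<psi> b) (r (t b))} | g. g \<in> carrier \<Gamma>})"

text \<open>Row \<open>b\<close> of the orbit rigidity matrix; the two summands are added when \<open>b\<close> is a loop. Here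
  \<open>q\<close> is the quotient of the placement, and \<open>a\<close> ranges over vertex orbits.\<close>

definition orbit_rigidity_matrix ::
  "nat \<Rightarrow> (int \<Rightarrow> real^'d^'d) \<Rightarrow> nat \<Rightarrow> ('e \<Rightarrow> 'a) \<Rightarrow> ('e \<Rightarrow> 'a) \<Rightarrow> ('e \<Rightarrow> int) \<Rightarrow> ('a \<Rightarrow> real^'d)
     \<Rightarrow> 'e \<Rightarrow> 'a \<times> 'd \<Rightarrow> complex" where
  "orbit_rigidity_matrix k \<tau> j s t \<psi> q b = (\<lambda>(a, i).
     (if a = s b then complex_of_real ((q (s b) - \<tau> (\<psi> b) *v q (t b)) $ i) else 0) +
     (if a = t b then unit_root k powi (int j * \<psi> b) *
        complex_of_real ((q (t b) - matrix_inv (\<tau> (\<psi> b)) *v q (s b)) $ i) else 0))"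

end

theory Submission
  imports Defs
begin

text \<open>
  A motion in the \<open>j\<close>-th isotypic subspace is determined by its values at the orbit representatives,
  which can be prescribed arbitrarily because the action on vertices is free; its image under the
  rigidity map is determined by the values at one edge of each orbit. In these coordinates the block
  has the entries of the orbit rigidity matrix with \<open>\<omega>\<close> replaced by its conjugate. Since \<open>p\<close> and
  \<open>\<tau>\<close> are real, the two matrices are entrywise conjugate, and a conjugate-linear injection
  preserves dimensions.
\<close>

section \<open>Conjugate-linear maps\<close>

lemma dim_conj_linear_image:
  fixes f :: "('a \<Rightarrow> complex) \<Rightarrow> 'b \<Rightarrow> complex"
  assumes add: "\<And>x y. f (x + y) = f x + f y"
    and scale: "\<And>c x. f (fun_scale c x) = fun_scale (cnj c) (f x)"
    and inj: "inj_on f (cfun.span S)"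
  shows "cfun.dim (f ` S) = cfun.dim S"
proof -
  have f0: "f 0 = 0"
    using add[of 0 0] by simp
  have spanned: "f x \<in> cfun.span (f ` T)" if "x \<in> cfun.span T" for x T
    using that
  proof (induction rule: cfun.span_induct_alt)
    case base
    then show ?case
      unfolding f0 by (rule cfun.span_zero)
  next
    case (step c x y)
    then show ?case
      unfolding add scale by (meson cfun.span_add cfun.span_scale cfun.span_base imageI)
  qed
  have spanned': "y \<in> f ` cfun.span T" if "y \<in> cfun.span (f ` T)" for y T
    using that
  proof (induction rule: cfun.span_induct_alt)
    case base
    then show ?case
      using cfun.span_zero f0 by force
  next
    case (step c x y)
    then obtain a b where ab: "a \<in> T" "x = f a" "b \<in> cfun.span T" "y = f b"
      by auto
    \<comment> \<open>The preimage carries the conjugated coefficient, which \<open>f\<close>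
      conjugates back to \<open>c\<close>.\<close>
    then have "fun_scale c x + y = f (fun_scale (cnj c) a + b)"
      by (simp only: add scale complex_cnj_cnj)
    moreover have "fun_scale (cnj c) a + b \<in> cfun.span T"
      using ab by (meson cfun.span_add cfun.span_scale cfun.span_base)
    ultimately show ?case
      by blast
  qed
  obtain B where B: "B \<subseteq> S" "cfun.independent B" "S \<subseteq> cfun.span B" "card B = cfun.dim S"
    by (rule cfun.basis_exists)
  have injB: "inj_on f (cfun.span B)"
    using inj B(1) by (meson cfun.span_mono inj_on_subset)
  have "cfun.independent (f ` B)"
    unfolding cfun.dependent_def
  proof clarify
    fix b assume b: "b \<in> B" "f b \<in> cfun.span (f ` B - {f b})"
    have "f ` B - {f b} \<subseteq> f ` (B - {b})"
      by auto
    then obtain x where x: "f b = f x" "x \<in> cfun.span (B - {b})"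
      using b spanned' cfun.span_mono by blast
    have "b = x"
      using injB x b cfun.span_base cfun.span_mono[of "B - {b}" B]
      by (metis Diff_subset inj_onD subsetD)
    then show False
      using B(2) b(1) x(2) by (auto simp: cfun.dependent_def)
  qed
  moreover have "f ` S \<subseteq> cfun.span (f ` B)"
    using B(3) spanned by auto
  moreover have "card (f ` B) = cfun.dim S"
    using B(4) injB by (metis card_image cfun.span_superset inj_on_subset)
  ultimately show ?thesis
    using B(1) by (intro cfun.dim_unique) auto
qed


section \<open>Complexified real matrices\<close>

lemma complex_matrix_mult:
  "complex_matrix (A ** B) = complex_matrix A ** complex_matrix B"
  by (simp add: complex_matrix_def matrix_matrix_mult_def vec_eq_iff)

lemma complex_matrix_mat_1: "complex_matrix (mat 1) = mat 1"
  by (simp add: complex_matrix_def mat_def vec_eq_iff)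

lemma matrix_inv_orthogonal_cancel:
  fixes A :: "real^'d^'d"
  assumes "orthogonal_matrix A"
  shows "A *v (matrix_inv A *v x) = x" and "matrix_inv A *v (A *v x) = x"
proof -
  \<comment> \<open>\<open>matrix_inv\<close> is defined by choice; the transpose witnesses that a
    two-sided inverse exists.\<close>
  have "\<exists>B. A ** B = mat 1 \<and> B ** A = mat 1"
    using assms orthogonal_matrix_def by blast
  then have "A ** matrix_inv A = mat 1 \<and> matrix_inv A ** A = mat 1"
    unfolding matrix_inv_def by (rule someI_ex)
  then show "A *v (matrix_inv A *v x) = x" "matrix_inv A *v (A *v x) = x"
    by (simp_all add: matrix_vector_mul_assoc)
qed

lemma unit_root_power: "k > 0 \<Longrightarrow> unit_root k ^ k = 1"
  by (simp add: unit_root_def flip: exp_of_nat_mult)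

lemma unit_root_nonzero: "unit_root k \<noteq> 0"
  by (simp add: unit_root_def)


section \<open>The block in orbit coordinates\<close>

locale cyclic_framework =
  fixes k :: nat
    and V :: "'v set" and E :: "'v set set"
    and \<theta> :: "int \<Rightarrow> 'v \<Rightarrow> 'v"
    and \<tau> :: "int \<Rightarrow> real^'d^'d"
    and p :: "'v \<Rightarrow> real^'d"
    and r :: "'v set \<Rightarrow> 'v"
    and s t :: "'v set set \<Rightarrow> 'v set"
    and \<psi> :: "'v set set \<Rightarrow> int"
  assumes k_pos: "k > 0"
    and \<theta>_hom: "\<theta> \<in> hom (integer_mod_group k) (graph_aut_group V E)"
    and free: "free_on (integer_mod_group k) V \<theta>"
    and \<tau>_hom: "\<tau> \<in> hom (integer_mod_group k) orthogonal_group"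
    and symmetric: "symmetric_framework (integer_mod_group k) \<theta> \<tau> V E p"
    and quotient: "quotient_gain_graph (integer_mod_group k) \<theta> V E r s t \<psi>"
begin

abbreviation \<Gamma> where "\<Gamma> \<equiv> integer_mod_group k"
abbreviation "vertex_orbits \<equiv> orbits \<Gamma> V \<theta>"
abbreviation "edge_orbits \<equiv> orbits \<Gamma> E (edge_action \<theta>)"

definition rep_edge :: "'v set set \<Rightarrow> 'v set" where
  "rep_edge b = {r (s b), \<theta> (\<psi> b) (r (t b))}"

sublocale group_action \<Gamma> V \<theta>
proof -
  \<comment> \<open>\<open>graph_aut_group\<close> only shrinks the carrier of
    \<open>BijGroup V\<close> and keeps its multiplication, so the homomorphism property carries
    over.\<close>
  have "\<theta> \<in> hom \<Gamma> (BijGroup V)"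
    using \<theta>_hom by (auto simp: hom_def graph_aut_group_def BijGroup_def Pi_iff)
  then show "group_action \<Gamma> V \<theta>"
    by (simp add: group_action_def group_hom_def group_hom_axioms_def group_BijGroup)
qed

lemma graph: "finite_simple_graph V E"
  using symmetric by (simp add: symmetric_framework_def framework_def)

lemma finite_vertices: "finite V"
  using graph by (simp add: finite_simple_graph_def)

lemma \<theta>_in: "g \<in> carrier \<Gamma> \<Longrightarrow> v \<in> V \<Longrightarrow> \<theta> g v \<in> V"
  by (rule element_image) auto

lemma p_image: "g \<in> carrier \<Gamma> \<Longrightarrow> v \<in> V \<Longrightarrow> p (\<theta> g v) = \<tau> g *v p v"
  using symmetric by (simp add: symmetric_framework_def)

lemma \<tau>_orthogonal: "g \<in> carrier \<Gamma> \<Longrightarrow> orthogonal_matrix (\<tau> g)"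
  using \<tau>_hom by (auto simp: hom_def orthogonal_group_def Pi_iff)

lemma \<tau>_mult: "g \<in> carrier \<Gamma> \<Longrightarrow> h \<in> carrier \<Gamma> \<Longrightarrow> \<tau> (g \<otimes>\<^bsub>\<Gamma>\<^esub> h) = \<tau> g ** \<tau> h"
  using \<tau>_hom by (auto simp: hom_def orthogonal_group_def)

lemma edge_action_in: "g \<in> carrier \<Gamma> \<Longrightarrow> e \<in> E \<Longrightarrow> edge_action \<theta> g e \<in> E"
proof -
  assume g: "g \<in> carrier \<Gamma>" and e: "e \<in> E"
  obtain u v where "u \<in> V" "v \<in> V" "e = {u, v}"
    using graph e unfolding finite_simple_graph_def by blast
  then show ?thesis
    using \<theta>_hom g e by (auto simp: hom_def graph_aut_group_def edge_action_def Pi_iff)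
qed

section \<open>Vertex orbits and coordinates of vertices under the free action\<close>

text \<open>If \<open>g\<close> and \<open>h\<close> agree at \<open>v\<close>, then the product of
  the inverse of \<open>h\<close> with \<open>g\<close> fixes \<open>v\<close>, so freeness makes it
  the identity.\<close>

lemma free_eq:
  assumes "g \<in> carrier \<Gamma>" "h \<in> carrier \<Gamma>" "v \<in> V" "\<theta> g v = \<theta> h v"
  shows "g = h"
proof -
  let ?i = "inv\<^bsub>\<Gamma>\<^esub> h"
  have i: "?i \<in> carrier \<Gamma>"
    using assms(2) by (rule group.inv_closed[OF group_integer_mod_group])
  have "\<theta> (?i \<otimes>\<^bsub>\<Gamma>\<^esub> g) v = \<theta> (?i \<otimes>\<^bsub>\<Gamma>\<^esub> h) v"
    using assms i by (simp only: composition_rule)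
  also have "\<dots> = v"
    using assms id_eq_one
    by (metis group.l_inv group_integer_mod_group restrict_apply')
  finally have "?i \<otimes>\<^bsub>\<Gamma>\<^esub> g = \<one>\<^bsub>\<Gamma>\<^esub>"
    using free assms i unfolding free_on_def
    by (meson group.is_monoid group_integer_mod_group monoid.m_closed)
  then show "g = h"
    using assms i
    by (metis group.inv_equality group.inv_inv group_integer_mod_group)
qed

lemma vertex_orbit_subset: "a \<in> vertex_orbits \<Longrightarrow> a \<subseteq> V"
  by (auto simp: orbits_def orbit_def \<theta>_in)

lemma rep_in: "a \<in> vertex_orbits \<Longrightarrow> r a \<in> a"
  using quotient by (simp add: quotient_gain_graph_def)

lemma rep_vertex: "a \<in> vertex_orbits \<Longrightarrow> r a \<in> V"
  using vertex_orbit_subset rep_in by blast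

lemma vertex_orbit_eq:
  assumes "a \<in> vertex_orbits" "x \<in> a"
  shows "a = orbit \<Gamma> \<theta> x"
proof -
  obtain y where y: "y \<in> V" "a = orbit \<Gamma> \<theta> y"
    using assms by (auto simp: orbits_def)
  have V: "z \<in> V" if "z \<in> a \<or> z \<in> orbit \<Gamma> \<theta> x" for z
    using that assms vertex_orbit_subset[OF assms(1)] by (auto simp: orbit_def \<theta>_in)
  show ?thesis
  proof
    show "a \<subseteq> orbit \<Gamma> \<theta> x"
      using V y assms(2) orbit_trans orbit_sym by (metis subsetI)
    show "orbit \<Gamma> \<theta> x \<subseteq> a"
      using V y assms(2) orbit_trans by (metis subsetI)
  qed
qed

lemma \<theta>_0: "v \<in> V \<Longrightarrow> \<theta> 0 v = v"
  using id_eq_one by (metis one_integer_mod_group restrict_apply')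

lemma vertex_eq_image_rep:
  assumes "v \<in> V"
  obtains a g where "a \<in> vertex_orbits" "g \<in> carrier \<Gamma>" "v = \<theta> g (r a)"
proof -
  have a: "orbit \<Gamma> \<theta> v \<in> vertex_orbits"
    using assms by (auto simp: orbits_def)
  then have "v \<in> orbit \<Gamma> \<theta> (r (orbit \<Gamma> \<theta> v))"
    using vertex_orbit_eq[OF _ rep_in] orbit_refl assms by blast
  then show thesis
    using that a by (auto simp: orbit_def)
qed

text \<open>Together with \<open>vertex_eq_image_rep\<close> this gives every vertex unique
  coordinates: an orbit and a group element. Equal images force equal orbits, and then
  \<open>free_eq\<close> applies at the common representative.\<close>

lemma image_rep_unique:
  assumes "a \<in> vertex_orbits" "b \<in> vertex_orbits" "g \<in> carrier \<Gamma>" "h \<in> carrier \<Gamma>"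
    and "\<theta> g (r a) = \<theta> h (r b)"
  shows "a = b" and "g = h"
proof -
  have "\<theta> g (r a) \<in> a" "\<theta> h (r b) \<in> b"
    using assms vertex_orbit_eq[OF _ rep_in] unfolding orbit_def by blast+
  then show "a = b"
    using assms vertex_orbit_eq by metis
  then show "g = h"
    using assms free_eq rep_vertex by blast
qed

lemma finite_vertex_orbits: "finite vertex_orbits"
  using finite_vertices by (auto simp: orbits_def)

section \<open>Edge orbits and their representative edges\<close>

lemma edge_orbit_ends:
  assumes "b \<in> edge_orbits"
  shows "s b \<in> vertex_orbits" "t b \<in> vertex_orbits" "\<psi> b \<in> carrier \<Gamma>"
  using quotient assms by (auto simp: quotient_gain_graph_def)

text \<open>The head of a lifted edge uses the product of \<open>g\<close> with the gain; the
  composition rule splits off \<open>g\<close>, leaving the translate of one fixed edge.\<close>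

lemma edge_orbit_eq:
  assumes "b \<in> edge_orbits"
  shows "b = {edge_action \<theta> g (rep_edge b) | g. g \<in> carrier \<Gamma>}"
proof -
  have "{\<theta> g (r (s b)), \<theta> (g \<otimes>\<^bsub>\<Gamma>\<^esub> \<psi> b) (r (t b))} = edge_action \<theta> g (rep_edge b)"
    if "g \<in> carrier \<Gamma>" for g
    using edge_orbit_ends[OF assms] that composition_rule rep_vertex
    by (simp add: edge_action_def rep_edge_def del: mult_integer_mod_group)
  moreover have "b = {{\<theta> g (r (s b)), \<theta> (g \<otimes>\<^bsub>\<Gamma>\<^esub> \<psi> b) (r (t b))} | g. g \<in> carrier \<Gamma>}"
    using quotient assms unfolding quotient_gain_graph_def by blast
  ultimately show ?thesis
    by (smt (verit) Collect_cong)
qed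

lemma edge_orbit_subset: "b \<in> edge_orbits \<Longrightarrow> b \<subseteq> E"
  by (auto simp: orbits_def orbit_def edge_action_in)

text \<open>The translate by the identity, which is \<open>0\<close> here, shows that
  \<open>rep_edge b\<close> belongs to the orbit \<open>b\<close>, and the orbit lies in
  \<open>E\<close>.\<close>

lemma rep_edge_in:
  assumes "b \<in> edge_orbits"
  shows "rep_edge b \<in> E"
proof -
  have "edge_action \<theta> 0 (rep_edge b) = rep_edge b"
    using edge_orbit_ends[OF assms] rep_vertex \<theta>_in \<theta>_0
    by (simp add: edge_action_def rep_edge_def)
  then have "rep_edge b \<in> {edge_action \<theta> g (rep_edge b) | g. g \<in> carrier \<Gamma>}"
    using integer_mod_group_0[of k] by (intro CollectI exI[of _ 0]) simp
  then have "rep_edge b \<in> b"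
    using edge_orbit_eq[OF assms] by (rule ssubst[rotated])
  then show ?thesis
    using edge_orbit_subset assms by blast
qed

lemma edge_eq_image_rep:
  assumes "e \<in> E"
  obtains b g where "b \<in> edge_orbits" "g \<in> carrier \<Gamma>" "e = edge_action \<theta> g (rep_edge b)"
proof -
  let ?b = "orbit \<Gamma> (edge_action \<theta>) e"
  obtain u v where "u \<in> V" "v \<in> V" "e = {u, v}"
    using graph assms unfolding finite_simple_graph_def by blast
  then have "edge_action \<theta> 0 e = e"
    by (simp add: edge_action_def \<theta>_0)
  then have "e \<in> ?b"
    using integer_mod_group_0[of k] unfolding orbit_def by (intro CollectI exI[of _ 0]) simp
  moreover have b: "?b \<in> edge_orbits"
    using assms by (auto simp: orbits_def)
  ultimately show thesis
    using that[OF b] edge_orbit_eq[OF b] by auto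
qed

section \<open>Characters and values at the identity\<close>

definition character :: "nat \<Rightarrow> int \<Rightarrow> complex" where
  "character j g = cnj (unit_root k) powi (int j * g)"

text \<open>The group product reduces the sum modulo \<open>k\<close>. The base is a
  \<open>k\<close>-th root of unity, so the multiple of \<open>k\<close> dropped from the exponent
  contributes a factor 1.\<close>

lemma character_mult: "character j (g \<otimes>\<^bsub>\<Gamma>\<^esub> h) = character j g * character j h"
proof -
  let ?w = "cnj (unit_root k)"
  have w: "?w \<noteq> 0" "?w ^ k = 1"
    using unit_root_nonzero unit_root_power[OF k_pos] by (auto simp flip: complex_cnj_power)
  have "?w powi (int k * n) = 1" for n
    using w by (simp add: power_int_mult)
  moreover have "int j * (g + h) = int k * (int j * ((g + h) div int k)) + int j * ((g + h) mod int k)"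
    by (metis (no_types, lifting) distrib_left mult.left_commute mult_div_mod_eq)
  ultimately have "?w powi (int j * (g + h)) = ?w powi (int j * ((g + h) mod int k))"
    using w by (simp add: power_int_add)
  then show ?thesis
    using w by (simp add: character_def distrib_left power_int_add)
qed

lemma character_0: "character j 0 = 1"
  by (simp add: character_def)

lemma cnj_character: "cnj (character j g) = unit_root k powi (int j * g)"
  by (simp add: character_def)

text \<open>An idempotent orthogonal matrix is the identity: multiply by its transpose.\<close>

lemma \<tau>_0: "\<tau> 0 = mat 1"
proof -
  have o: "orthogonal_matrix (\<tau> 0)" and "\<tau> 0 ** \<tau> 0 = \<tau> 0"
    using \<tau>_orthogonal[of 0] \<tau>_mult[of 0 0] by auto
  then show ?thesis
    by (metis matrix_mul_assoc matrix_mul_lid orthogonal_matrix)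
qed

section \<open>Motions prescribed at the representatives\<close>

text \<open>The choice below is well defined by freeness of the action on the vertices.\<close>

definition extend :: "nat \<Rightarrow> ('v set \<Rightarrow> complex^'d) \<Rightarrow> 'v \<Rightarrow> complex^'d" where
  "extend j c v = (if v \<in> V then
     (case (SOME (a, g). a \<in> vertex_orbits \<and> g \<in> carrier \<Gamma> \<and> v = \<theta> g (r a)) of
       (a, g) \<Rightarrow> character j g *s (complex_matrix (\<tau> g) *v c a)) else 0)"

lemma extend_image_rep:
  assumes "a \<in> vertex_orbits" "g \<in> carrier \<Gamma>"
  shows "extend j c (\<theta> g (r a)) = character j g *s (complex_matrix (\<tau> g) *v c a)"
proof -
  let ?P = "\<lambda>(a', g'). a' \<in> vertex_orbits \<and> g' \<in> carrier \<Gamma> \<and> \<theta> g (r a) = \<theta> g' (r a')"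
  have "x = (a, g)" if "?P x" for x
  proof (cases x)
    case (Pair a' g')
    then have "a = a'" "g = g'"
      using that image_rep_unique[OF assms(1) _ assms(2), of a' g'] by auto
    then show ?thesis
      using Pair by simp
  qed
  then have "Eps ?P = (a, g)"
    by (intro some_equality) (use assms in auto)
  then show ?thesis
    using assms by (simp add: extend_def \<theta>_in rep_vertex)
qed

lemma extend_rep:
  assumes "a \<in> vertex_orbits"
  shows "extend j c (r a) = c a"
  using extend_image_rep[OF assms, of 0] \<theta>_0[OF rep_vertex[OF assms]]
  by (simp add: character_0 \<tau>_0 complex_matrix_mat_1)

text \<open>In the coordinates of a vertex, acting by \<open>g\<close> multiplies the group element
  by \<open>g\<close> on the left. Both \<open>character j\<close> and \<open>\<tau>\<close> are
  multiplicative, so the factors belonging to \<open>g\<close> split off.\<close>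

lemma extend_in_isotypic: "extend j c \<in> motion_isotypic k \<theta> \<tau> j V"
proof -
  have "extend j c (\<theta> g v) = character j g *s (complex_matrix (\<tau> g) *v extend j c v)"
    if g: "g \<in> carrier \<Gamma>" and v: "v \<in> V" for g v
  proof -
    obtain a h where a: "a \<in> vertex_orbits" "h \<in> carrier \<Gamma>" "v = \<theta> h (r a)"
      using vertex_eq_image_rep v by metis
    have gh: "g \<otimes>\<^bsub>\<Gamma>\<^esub> h \<in> carrier \<Gamma>"
      using g a(2) by (simp add: group.is_monoid monoid.m_closed del: mult_integer_mod_group)
    have "\<theta> g v = \<theta> (g \<otimes>\<^bsub>\<Gamma>\<^esub> h) (r a)"
      using a g rep_vertex composition_rule by simp
    then have "extend j c (\<theta> g v)
        = character j (g \<otimes>\<^bsub>\<Gamma>\<^esub> h) *s (complex_matrix (\<tau> (g \<otimes>\<^bsub>\<Gamma>\<^esub> h)) *v c a)"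
      using extend_image_rep[OF a(1) gh] by simp
    also have "\<dots> = character j g *s (complex_matrix (\<tau> g) *v extend j c v)"
      unfolding character_mult \<tau>_mult[OF g a(2)] a(3) extend_image_rep[OF a(1,2)]
      by (simp add: complex_matrix_mult vector_scalar_commute matrix_vector_mul_assoc
          vector_smult_assoc)
    finally show ?thesis .
  qed
  then show ?thesis
    by (simp add: motion_isotypic_def extend_def character_def)
qed

section \<open>Comparison of the block with the orbit rigidity matrix\<close>

text \<open>Equivariance expresses the value of \<open>m\<close> at the head of
  \<open>rep_edge b\<close> through its value at the representative of the head orbit. Conjugating
  the result turns the character into the power of \<open>unit_root k\<close> in row
  \<open>b\<close>.\<close>

lemma rigidity_map_rep_edge:
  assumes m: "m \<in> motion_isotypic k \<theta> \<tau> j V" and b: "b \<in> edge_orbits"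
  shows "cnj (rigidity_map V E p m (rep_edge b)) =
    (\<Sum>(a, i)\<in>vertex_orbits \<times> UNIV.
       cnj (m (r a) $ i) * orbit_rigidity_matrix k \<tau> j s t \<psi> (\<lambda>a. p (r a)) b (a, i))"
proof -
  define u v h where "u = r (s b)" and "v = r (t b)" and "h = \<psi> b"
  let ?A = "\<tau> h" and ?c = "character j h"
  have in_V: "u \<in> V" "v \<in> V" "h \<in> carrier \<Gamma>" "\<theta> h v \<in> V"
    using edge_orbit_ends[OF b] rep_vertex \<theta>_in by (auto simp: u_def v_def h_def)
  have e: "rep_edge b = {u, \<theta> h v}"
    by (simp add: rep_edge_def u_def v_def h_def)
  then have edge: "{u, \<theta> h v} \<in> E"
    using rep_edge_in[OF b] by simp
  \<comment> \<open>This covers loops too: there \<open>u = v\<close>, but the lifted edge still has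
    two distinct ends.\<close>
  then have "u \<noteq> \<theta> h v"
    using graph by (auto simp: finite_simple_graph_def doubleton_eq_iff)
  then have "rigidity_map V E p m (rep_edge b)
      = (\<Sum>i\<in>UNIV. complex_of_real ((p u - p (\<theta> h v)) $ i) * (m u - m (\<theta> h v)) $ i)"
    unfolding e using edge in_V finite_vertices by (intro rigidity_map_edge)
  also have "\<dots> = (\<Sum>i\<in>UNIV. complex_of_real ((p u - ?A *v p v) $ i) * m u $ i)
      + ?c * (\<Sum>i\<in>UNIV. complex_of_real ((?A *v p v - p u) $ i) * (complex_matrix ?A *v m v) $ i)"
  proof -
    have "m (\<theta> h v) = ?c *s (complex_matrix ?A *v m v)"
      using m in_V by (simp add: motion_isotypic_def character_def)
    then show ?thesis
      using in_V by (simp add: p_image sum.distrib[symmetric] sum_distrib_left algebra_simps)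
  qed
  \<comment> \<open>Pulling \<open>\<tau> h\<close> out of the difference makes it act on both
    factors of the bilinear form, where orthogonality cancels it.\<close>
  also have "?A *v p v - p u = ?A *v (p v - matrix_inv ?A *v p u)"
    by (simp add: matrix_vector_mult_diff_distrib matrix_inv_orthogonal_cancel
        \<tau>_orthogonal[OF in_V(3)])
  also have "(\<Sum>i\<in>UNIV. complex_of_real ((?A *v (p v - matrix_inv ?A *v p u)) $ i)
        * (complex_matrix ?A *v m v) $ i)
      = (\<Sum>i\<in>UNIV. complex_of_real ((p v - matrix_inv ?A *v p u) $ i) * m v $ i)"
    by (rule orthogonal_bilinear[OF \<tau>_orthogonal[OF in_V(3)]])
  finally have "cnj (rigidity_map V E p m (rep_edge b))
      = (\<Sum>i\<in>UNIV. cnj (m u $ i) * complex_of_real ((p u - ?A *v p v) $ i))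
      + (\<Sum>i\<in>UNIV. cnj (m v $ i) * (unit_root k powi (int j * h) *
           complex_of_real ((p v - matrix_inv ?A *v p u) $ i)))"
    by (simp add: cnj_character sum_distrib_left mult_ac)
  also have "\<dots> = (\<Sum>a\<in>vertex_orbits. \<Sum>i\<in>UNIV.
       cnj (m (r a) $ i) * orbit_rigidity_matrix k \<tau> j s t \<psi> (\<lambda>a. p (r a)) b (a, i))"
  proof -
    \<comment> \<open>For a loop both conditions hold at the same orbit and the two contributions
      add, as in the matrix.\<close>
    have split: "(\<Sum>i\<in>UNIV. cnj (m (r a) $ i)
          * orbit_rigidity_matrix k \<tau> j s t \<psi> (\<lambda>a. p (r a)) b (a, i))
        = (if a = s b then \<Sum>i\<in>UNIV. cnj (m u $ i) * complex_of_real ((p u - ?A *v p v) $ i) else 0)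
        + (if a = t b then \<Sum>i\<in>UNIV. cnj (m v $ i) * (unit_root k powi (int j * h) *
             complex_of_real ((p v - matrix_inv ?A *v p u) $ i)) else 0)" for a
      by (auto simp: orbit_rigidity_matrix_def u_def v_def h_def distrib_left sum.distrib)
    show ?thesis
      unfolding split sum.distrib using finite_vertex_orbits edge_orbit_ends[OF b] by simp
  qed
  finally show ?thesis
    by (simp add: sum.cartesian_product)
qed

text \<open>Reads a stress at one edge per orbit. The conjugation makes the result a combination of
  columns of the orbit matrix itself rather than of its conjugate.\<close>

definition conj_rep :: "('v set \<Rightarrow> complex) \<Rightarrow> 'v set set \<Rightarrow> complex" where
  "conj_rep w = (\<lambda>b. if b \<in> edge_orbits then cnj (w (rep_edge b)) else 0)"

lemma subspace_stress_isotypic: "cfun.subspace (stress_isotypic k \<theta> j E)"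
  by (auto simp: cfun.subspace_def stress_isotypic_def fun_scale_def algebra_simps edge_action_in)

text \<open>Every edge is a translate of a representative edge, and the isotypic condition fixes the
  value at a translate; outside \<open>E\<close> both stresses vanish.\<close>

lemma inj_on_conj_rep: "inj_on conj_rep (stress_isotypic k \<theta> j E)"
proof (rule inj_onI)
  fix w w' assume w: "w \<in> stress_isotypic k \<theta> j E" "w' \<in> stress_isotypic k \<theta> j E"
    and eq: "conj_rep w = conj_rep w'"
  have rep: "w (rep_edge b) = w' (rep_edge b)" if "b \<in> edge_orbits" for b
    using fun_cong[OF eq, of b] that by (simp add: conj_rep_def)
  show "w = w'"
  proof
    fix e
    show "w e = w' e"
    proof (cases "e \<in> E")
      case True
      then obtain b g where "b \<in> edge_orbits" "g \<in> carrier \<Gamma>" "e = edge_action \<theta> g (rep_edge b)"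
        using edge_eq_image_rep by metis
      then show ?thesis
        using w rep rep_edge_in by (simp add: stress_isotypic_def)
    qed (use w in \<open>simp add: stress_isotypic_def\<close>)
  qed
qed

theorem block_rank_eq:
  "block_rank k \<theta> \<tau> j V E p =
    matrix_rank_on edge_orbits (vertex_orbits \<times> UNIV)
      (orbit_rigidity_matrix k \<tau> j s t \<psi> (\<lambda>a. p (r a)))"
proof -
  let ?O = "orbit_rigidity_matrix k \<tau> j s t \<psi> (\<lambda>a. p (r a))"
  let ?J = "motion_isotypic k \<theta> \<tau> j V"
  let ?W = "block_map k \<theta> \<tau> j V E p ` ?J"
  define col where "col = (\<lambda>x b. if b \<in> edge_orbits then ?O b x else 0)"
  let ?C = "col ` (vertex_orbits \<times> UNIV)"
  have fin: "finite (vertex_orbits \<times> (UNIV :: 'd set))"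
    using finite_vertex_orbits by simp
  \<comment> \<open>The conjugated coordinates of \<open>m\<close> at the representatives are the
    coefficients of the columns.\<close>
  have expand: "conj_rep (block_map k \<theta> \<tau> j V E p m)
      = (\<Sum>x\<in>vertex_orbits \<times> UNIV. fun_scale (cnj (m (r (fst x)) $ snd x)) (col x))"
    if "m \<in> ?J" for m
  proof
    fix b
    have "(\<Sum>x\<in>vertex_orbits \<times> UNIV. fun_scale (cnj (m (r (fst x)) $ snd x)) (col x)) b
        = (\<Sum>x\<in>vertex_orbits \<times> UNIV. fun_scale (cnj (m (r (fst x)) $ snd x)) (col x) b)"
      using fin by (induction rule: finite_induct) auto
    then show "conj_rep (block_map k \<theta> \<tau> j V E p m) b
        = (\<Sum>x\<in>vertex_orbits \<times> UNIV. fun_scale (cnj (m (r (fst x)) $ snd x)) (col x)) b"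
      using that rigidity_map_rep_edge[OF that, of b]
      by (simp add: conj_rep_def block_map_def col_def fun_scale_def case_prod_unfold)
  qed
  have "conj_rep (block_map k \<theta> \<tau> j V E p m) \<in> cfun.span ?C" if "m \<in> ?J" for m
    unfolding expand[OF that] by (rule cfun.span_sum, rule cfun.span_scale, rule cfun.span_base) blast
  then have "conj_rep ` ?W \<subseteq> cfun.span ?C"
    by blast
  moreover have "?C \<subseteq> conj_rep ` ?W"
  proof clarify
    fix a i assume a: "a \<in> vertex_orbits"
    \<comment> \<open>The motion extending the unit vector in direction \<open>i\<close> at orbit
      \<open>a\<close> and zero at the other representatives: all coefficients but that of column
      \<open>(a, i)\<close> vanish.\<close>
    define m where "m = extend j (\<lambda>a'. if a' = a then axis i 1 else 0)"
    have m: "m \<in> ?J"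
      unfolding m_def by (rule extend_in_isotypic)
    have "fun_scale (cnj (m (r (fst x)) $ snd x)) (col x) = (if x = (a, i) then col x else 0)"
      if "x \<in> vertex_orbits \<times> UNIV" for x
      using that by (auto simp: m_def extend_rep axis_def fun_scale_def zero_fun_def)
    then have col: "conj_rep (block_map k \<theta> \<tau> j V E p m) = col (a, i)"
      unfolding expand[OF m] using fin a by simp
    show "col (a, i) \<in> conj_rep ` ?W"
      unfolding col[symmetric] by (intro imageI m)
  qed
  \<comment> \<open>Equality of spans suffices, since \<open>cfun.dim\<close> of a set depends only
    on its span.\<close>
  ultimately have "cfun.span (conj_rep ` ?W) = cfun.span ?C"
    by (intro equalityI cfun.span_minimal[OF _ cfun.subspace_span] cfun.span_mono)
  then have "cfun.dim (conj_rep ` ?W) = cfun.dim ?C"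
    by (rule cfun.span_eq_dim)
  moreover have "cfun.dim (conj_rep ` ?W) = cfun.dim ?W"
  proof (rule dim_conj_linear_image)
    \<comment> \<open>Injectivity is known only on the stress isotypic space; being a subspace, it
      contains the span of the block's image.\<close>
    have "?W \<subseteq> stress_isotypic k \<theta> j E"
      using block_map_in[OF \<theta>_hom \<tau>_hom symmetric] by (rule funcset_image)
    then have "cfun.span ?W \<subseteq> stress_isotypic k \<theta> j E"
      using subspace_stress_isotypic by (rule cfun.span_minimal)
    then show "inj_on conj_rep (cfun.span ?W)"
      by (rule inj_on_subset[OF inj_on_conj_rep])
  qed (simp_all add: fun_eq_iff conj_rep_def fun_scale_def)
  ultimately show ?thesis
    unfolding block_rank_def map_rank_def matrix_rank_on_def col_def by simp
qed

end

theorem proposition4p1: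
  fixes k j :: nat
    and V :: "'v set" and E :: "'v set set"
    and \<theta> :: "int \<Rightarrow> 'v \<Rightarrow> 'v"
    and \<tau> :: "int \<Rightarrow> real^'d^'d"
    and p :: "'v \<Rightarrow> real^'d"
    and r :: "'v set \<Rightarrow> 'v"
    and s t :: "'v set set \<Rightarrow> 'v set"
    and \<psi> :: "'v set set \<Rightarrow> int"
  defines "\<Gamma> \<equiv> integer_mod_group k"
  assumes "k > 0"
    and "finite_simple_graph V E"
    and "\<theta> \<in> hom \<Gamma> (graph_aut_group V E)"
    and "free_on \<Gamma> V \<theta>" and "free_on \<Gamma> E (edge_action \<theta>)"
    and "\<tau> \<in> hom \<Gamma> orthogonal_group"
    and "symmetric_framework \<Gamma> \<theta> \<tau> V E p"
    and "quotient_gain_graph \<Gamma> \<theta> V E r s t \<psi>"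
    and "j < k"
  shows "block_rank k \<theta> \<tau> j V E p =
    matrix_rank_on (orbits \<Gamma> E (edge_action \<theta>)) (orbits \<Gamma> V \<theta> \<times> UNIV)
      (orbit_rigidity_matrix k \<tau> j s t \<psi> (\<lambda>a. p (r a)))"
proof -
  interpret cyclic_framework k V E \<theta> \<tau> p r s t \<psi>
    using assms by unfold_locales (simp_all add: \<Gamma>_def)
  show ?thesis
    unfolding \<Gamma>_def by (rule block_rank_eq)
qed

end
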